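(* Consider matrices $\mathbf P_{ep}\in\mathbb R^{\tilde N_p\times M_p}$, $\mathbf P_{eq}\in\mathbb R^{\tilde N_q\times M_q}$, $\mathbf P_{fp}\in\mathbb R^{\tilde N_p\times N_p}$, $\mathbf P_{fq}\in\mathbb R^{\tilde N_q\times N_q}$ (effort and flow maps), $\mathbf d_p\in\mathbb R^{N_p\times M_q}$, $\mathbf d_q\in\mathbb R^{N_q\times M_p}$ (discrete derivative matrices), $\mathbf T_q\in\mathbb R^{M_b\times M_q}$, $\hat{\mathbf T}_p\in\mathbb R^{\hat M_b\times M_p}$ (boundary trace matrices), $\mathbf S_p\in\mathbb R^{M_b\times M_p}$, $\hat{\mathbf S}_q\in\mathbb R^{\hat M_b\times M_q}$ (boundary output matrices), and for $\mathbf e=(\mathbf e^p,\mathbf e^q)\in\mathbb R^{M_p+M_q}$ define the flow and effort vectors $$\bar{\mathbf f}=\begin{bmatrix}\tilde{\mathbf f}^p\\ \tilde{\mathbf f}^q\\ \hat{\mathbf f}^b\\ \mathbf f^b\end{bmatrix}=\mathbf E^T\mathbf e,\quad \mathbf E^T=\begin{bmatrix}\mathbf 0&(-1)^r\mathbf P_{fp}\mathbf d_p\\ \mathbf P_{fq}\mathbf d_q&\mathbf 0\\ \mathbf 0&\hat{\mathbf S}_q\\ \mathbf S_p&\mathbf 0\end{bmatrix},\qquad \bar{\mathbf e}=\begin{bmatrix}\tilde{\mathbf e}^p\\ \tilde{\mathbf e}^q\\ \hat{\mathbf e}^b\\ \mathbf e^b\end{bmatrix}=\mathbf F^T\mathbf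 e,\quad \mathbf F^T=\begin{bmatrix}\mathbf P_{ep}&\mathbf 0\\ \mathbf 0&\mathbf P_{eq}\\ \hat{\mathbf T}_p&\mathbf 0\\ \mathbf 0&\mathbf T_q\end{bmatrix}.$$ The pair $(\bar{\mathbf f},\bar{\mathbf e})$ is an element of the bond space $\bar{\mathcal F}\times\bar{\mathcal E}=\mathbb R^{\tilde N_p+\tilde N_q+M_b+\hat M_b}\times\mathbb R^{\tilde N_p+\tilde N_q+M_b+\hat M_b}$. Let $\tilde N_p+\tilde N_q+\hat M_b+M_b=M_p+M_q$ and assume that $$(-1)^r\mathbf d_p^T\mathbf P_{fp}^T\mathbf P_{ep}+\mathbf P_{eq}^T\mathbf P_{fq}\mathbf d_q+\mathbf T_q^T\mathbf S_p+\hat{\mathbf S}_q^T\hat{\mathbf T}_p=\mathbf 0.$$ If $$\mathrm{rank}\begin{bmatrix}\mathbf P_{ep}\\ \hat{\mathbf T}_p\end{bmatrix}=M_p\qquad\text{and}\qquad\mathrm{rank}\begin{bmatrix}\mathbf P_{eq}\\ \mathbf T_q\end{bmatrix}=M_q,$$ then the subspace $$\bar D=\{(\bar{\mathbf f},\bar{\mathbf e})\in\bar{\mathcal F}\times\bar{\mathcal E}\;|\;\bar{\mathbf f}=\mathbf E^T\mathbf e,\ \bar{\mathbf e}=\mathbf F^T\mathbf e,\ \mathbf e\in\mathbb R^{M_p+M_q}\}$$ is a Dirac structure.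
   Context: The integers $N_p,N_q,M_p,M_q,M_b,\hat M_b,\tilde N_p,\tilde N_q$ are the dimensions of the discrete (Galerkin) flow vectors $\mathbf f^p,\mathbf f^q$, effort vectors $\mathbf e^p,\mathbf e^q$, boundary port vectors of the two causalities, and minimal flow/effort vectors, respectively. Degrees $p,q$ satisfy $p+q=n+1$ and $r=pq+1$ is an integer exponent. The discrete flows are related to the discrete efforts by the discrete conservation laws $\mathbf f^p=(-1)^r\mathbf d_p\mathbf e^q$, $\mathbf f^q=\mathbf d_q\mathbf e^p$. A Dirac structure on a finite-dimensional space $V\times V^*$ (here $V=\bar{\mathcal F}$, $V^*=\bar{\mathcal E}$, with the standard Euclidean pairing $\langle\bar{\mathbf e}|\bar{\mathbf f}\rangle=\bar{\mathbf e}^T\bar{\mathbf f}$) is a linear subspace that is maximally isotropic under the symmetric bilinear form $\langle\langle(\mathbf f_1,\mathbf e_1),(\mathbf f_2,\mathbf e_2)\rangle\rangle=\tfrac12(\langle\mathbf e_1|\mathbf f_2\rangle+\langle\mathbf e_2|\mathbf f_1\rangle)$, equivalently one that equals its own orthogonal complement with respect to this form. *)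

theory Defs
  imports "Jordan_Normal_Form.DL_Rank"
begin

text \<open>
  Dimensions are natural numbers and may be zero (so that, e.g., one of the two boundary
  causalities may be absent); vectors and matrices are those of the Jordan normal form library with explicit
  carriers. An element of the bond space is a pair (f, e): the flow comes first, the effort second.
\<close>

definition bond_space :: "nat \<Rightarrow> (real, real vec \<times> real vec) module" where
  "bond_space N = direct_sum (module_vec TYPE(real) N) (module_vec TYPE(real) N)"

definition bond_form :: "real vec \<times> real vec \<Rightarrow> real vec \<times> real vec \<Rightarrow> real" where
  "bond_form x y = (snd x \<bullet> fst y + snd y \<bullet> fst x) / 2"

definition isotropic_subspace :: "nat \<Rightarrow> (real vec \<times> real vec) set \<Rightarrow> bool" where
  "isotropic_subspace N D \<longleftrightarrow>
     VectorSpace.subspace class_ring D (bond_space N) \<and> (\<forall>x\<in>D. \<forall>y\<in>D. bond_form x y = 0)"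

lemma isotropic_subspace_iff:
  "isotropic_subspace N D \<longleftrightarrow>
     D \<subseteq> carrier_vec N \<times> carrier_vec N \<and> (0\<^sub>v N, 0\<^sub>v N) \<in> D \<and>
     (\<forall>x\<in>D. \<forall>y\<in>D. (fst x + fst y, snd x + snd y) \<in> D) \<and>
     (\<forall>c. \<forall>x\<in>D. (c \<cdot>\<^sub>v fst x, c \<cdot>\<^sub>v snd x) \<in> D) \<and>
     (\<forall>x\<in>D. \<forall>y\<in>D. bond_form x y = 0)"
proof -
  interpret V: vec_space "TYPE(real)" N .
  have m: "module class_ring (bond_space N)"
    unfolding bond_space_def by (intro direct_sum_is_module V.module_axioms)
  have vs: "vectorspace class_ring (bond_space N)"
    unfolding vectorspace_def using m class_field by blast
  show ?thesis
    unfolding isotropic_subspace_def VectorSpace.subspace_def submodule_def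
    using vs m
    by (auto simp: bond_space_def direct_sum_def module_vec_def class_ring_simps) force+
qed

definition dirac_structure :: "nat \<Rightarrow> (real vec \<times> real vec) set \<Rightarrow> bool" where
  "dirac_structure N D \<longleftrightarrow>
     isotropic_subspace N D \<and> (\<forall>D'. isotropic_subspace N D' \<and> D \<subseteq> D' \<longrightarrow> D' = D)"

text \<open>
  The matrices mapping the discrete efforts (first the p-block, then the q-block) to the stacked flows and efforts; both have four block
  rows and two block columns. \<open>Shq\<close> and \<open>Thp\<close> stand for the hatted matrices.
\<close>

definition flow_matrix ::
  "nat \<Rightarrow> real mat \<Rightarrow> real mat \<Rightarrow> real mat \<Rightarrow> real mat \<Rightarrow> real mat \<Rightarrow> real mat \<Rightarrow> real mat" where
  "flow_matrix r Pfp Pfq dp dq Sp Shq =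
     four_block_mat
       (0\<^sub>m (dim_row Pfp) (dim_col dq))  ((-1) ^ r \<cdot>\<^sub>m (Pfp * dp))
       (Pfq * dq)                        (0\<^sub>m (dim_row Pfq) (dim_col dp))
     @\<^sub>r
     four_block_mat
       (0\<^sub>m (dim_row Shq) (dim_col Sp))  Shq
       Sp                                (0\<^sub>m (dim_row Sp) (dim_col Shq))"

definition effort_matrix :: "real mat \<Rightarrow> real mat \<Rightarrow> real mat \<Rightarrow> real mat \<Rightarrow> real mat" where
  "effort_matrix Pep Peq Tq Thp =
     four_block_mat
       Pep                                (0\<^sub>m (dim_row Pep) (dim_col Peq))
       (0\<^sub>m (dim_row Peq) (dim_col Pep))  Peq
     @\<^sub>r
     four_block_mat
       Thp                                (0\<^sub>m (dim_row Thp) (dim_col Tq))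
       (0\<^sub>m (dim_row Tq) (dim_col Thp))   Tq"

end

theory Submission
  imports Defs
begin

text \<open>
  Write \<open>A\<close> and \<open>G\<close> for the flow and effort matrices, so that the subspace in question is the set of
  all pairs \<open>(A u, G u)\<close>. The matrix equation between the blocks says that \<open>G\<^sup>T A\<close> is skew-symmetric,
  which is isotropy of this set. Up to the order of its rows, \<open>G\<close> is block diagonal with the blocks
  \<open>Pep @\<^sub>r Thp\<close> and \<open>Peq @\<^sub>r Tq\<close>; both have full column rank, so \<open>G\<close> is injective, and being square it is
  onto. Hence if \<open>(f, e)\<close> lies in a larger isotropic subspace, then \<open>e = G u\<close> for some \<open>u\<close>, and
  \<open>(f - A u, 0)\<close> lies there too. It is orthogonal to all pairs \<open>(A v, G v)\<close>, so \<open>f - A u\<close> is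
  Euclidean-orthogonal to the whole range of \<open>G\<close> and therefore vanishes (lemma
  \<open>dirac_structure_image_rep\<close>).
\<close>

lemma (in vec_space) full_column_rank_kernel:
  assumes A: "A \<in> carrier_mat n nc" and rank: "rank A = nc"
    and v: "v \<in> carrier_vec nc" "A *\<^sub>v v = 0\<^sub>v n"
  shows "v = 0\<^sub>v nc"
proof -
  \<comment> \<open>A repeated column would bound the rank by the number of different columns, less than \<open>nc\<close>.\<close>
  have "distinct (cols A)"
  proof (rule ccontr)
    assume "\<not> distinct (cols A)"
    then have lt: "card (set (cols A)) < nc"
      using A by (metis card_distinct card_length carrier_matD(2) cols_length nat_less_le)
    obtain S where S: "maximal S (\<lambda>T. T \<subseteq> set (cols A) \<and> lin_indpt T)"
      using maximal_exists[of "(\<lambda>T. T \<subseteq> set (cols A) \<and> lin_indpt T)" "card (set (cols A))" "{}"]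
      by (meson List.finite_set card_mono empty_iff empty_subsetI finite_lin_indpt2 rev_finite_subset)
    then have "card S \<le> card (set (cols A))"
      by (simp add: card_mono maximal_def)
    with lt rank rank_card_indpt[OF A S] show False by simp
  qed
  then show ?thesis
    using full_rank_lin_indpt[OF A rank] lin_depI[OF A v(1) _ v(2)] by blast
qed

lemma injective_square_mat_surj:
  fixes G :: "'a :: field mat"
  assumes G: "G \<in> carrier_mat N N"
    and inj: "\<And>u. u \<in> carrier_vec N \<Longrightarrow> G *\<^sub>v u = 0\<^sub>v N \<Longrightarrow> u = 0\<^sub>v N"
    and e: "e \<in> carrier_vec N"
  shows "\<exists>u\<in>carrier_vec N. G *\<^sub>v u = e"
proof -
  have "det G \<noteq> 0"
    using det_0_iff_vec_prod_zero_field[OF G] inj by blast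
  then obtain B where B: "B \<in> carrier_mat N N" "G * B = 1\<^sub>m N"
    using det_non_zero_imp_unit[OF G] by (auto simp: Units_def ring_mat_def)
  have "G *\<^sub>v (B *\<^sub>v e) = e"
    using assoc_mult_mat_vec[OF G B(1) e] B(2) e by simp
  then show ?thesis
    using B(1) e by (intro bexI[of _ "B *\<^sub>v e"]) auto
qed

text \<open>An image representation \<open>(A u, G u)\<close> with \<open>G\<^sup>T A\<close> skew-symmetric and \<open>G\<close> onto is a Dirac structure.\<close>

lemma dirac_structure_image_rep:
  fixes A G :: "real mat"
  assumes A: "A \<in> carrier_mat N M" and G: "G \<in> carrier_mat N M"
    and surj: "\<And>e. e \<in> carrier_vec N \<Longrightarrow> \<exists>u\<in>carrier_vec M. G *\<^sub>v u = e"
    and skew: "\<And>u v. u \<in> carrier_vec M \<Longrightarrow> v \<in> carrier_vec M \<Longrightarrow>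
                 (G *\<^sub>v u) \<bullet> (A *\<^sub>v v) + (G *\<^sub>v v) \<bullet> (A *\<^sub>v u) = 0"
  shows "dirac_structure N
           {(f, e). f \<in> carrier_vec N \<and> e \<in> carrier_vec N \<and>
              (\<exists>u \<in> carrier_vec M. f = A *\<^sub>v u \<and> e = G *\<^sub>v u)}"
    (is "dirac_structure N ?D")
proof -
  have D_eq: "?D = (\<lambda>u. (A *\<^sub>v u, G *\<^sub>v u)) ` carrier_vec M"
    using A G by auto
  have zero: "(0\<^sub>v N, 0\<^sub>v N) \<in> ?D"
    unfolding D_eq using A G by (intro image_eqI[of _ _ "0\<^sub>v M"]) auto
  have add: "(fst x + fst y, snd x + snd y) \<in> ?D" if "x \<in> ?D" "y \<in> ?D" for x y
  proof -
    from that obtain u v where "u \<in> carrier_vec M" "v \<in> carrier_vec M"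
      "x = (A *\<^sub>v u, G *\<^sub>v u)" "y = (A *\<^sub>v v, G *\<^sub>v v)"
      unfolding D_eq by blast
    then show ?thesis
      unfolding D_eq using A G
      by (intro image_eqI[of _ _ "u + v"]) (auto simp: mult_add_distrib_mat_vec)
  qed
  have smult: "(c \<cdot>\<^sub>v fst x, c \<cdot>\<^sub>v snd x) \<in> ?D" if "x \<in> ?D" for c x
  proof -
    from that obtain u where "u \<in> carrier_vec M" "x = (A *\<^sub>v u, G *\<^sub>v u)"
      unfolding D_eq by blast
    then show ?thesis
      unfolding D_eq using A G
      by (intro image_eqI[of _ _ "c \<cdot>\<^sub>v u"]) (auto simp: mult_mat_vec)
  qed
  have form: "bond_form x y = 0" if "x \<in> ?D" "y \<in> ?D" for x y
  proof -
    from that obtain u v where "u \<in> carrier_vec M" "v \<in> carrier_vec M"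
      "x = (A *\<^sub>v u, G *\<^sub>v u)" "y = (A *\<^sub>v v, G *\<^sub>v v)"
      unfolding D_eq by blast
    then show ?thesis unfolding bond_form_def by (simp add: skew)
  qed
  have sub: "?D \<subseteq> carrier_vec N \<times> carrier_vec N"
    by auto
  have iso: "isotropic_subspace N ?D"
    unfolding isotropic_subspace_iff
    by (intro conjI allI ballI sub zero add smult form)
  moreover have "D' = ?D" if D': "isotropic_subspace N D'" "?D \<subseteq> D'" for D'
  proof (intro equalityI D'(2) subrelI)
    fix f e assume fe: "(f, e) \<in> D'"
    have sub': "D' \<subseteq> carrier_vec N \<times> carrier_vec N"
      and add': "\<And>x y. x \<in> D' \<Longrightarrow> y \<in> D' \<Longrightarrow> (fst x + fst y, snd x + snd y) \<in> D'"
      and smult': "\<And>c x. x \<in> D' \<Longrightarrow> (c \<cdot>\<^sub>v fst x, c \<cdot>\<^sub>v snd x) \<in> D'"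
      and form': "\<And>x y. x \<in> D' \<Longrightarrow> y \<in> D' \<Longrightarrow> bond_form x y = 0"
      using D'(1) unfolding isotropic_subspace_iff by simp_all
    have car: "f \<in> carrier_vec N" "e \<in> carrier_vec N"
      using fe sub' by auto
    have D'_mem: "(A *\<^sub>v v, G *\<^sub>v v) \<in> D'" if "v \<in> carrier_vec M" for v
      using D'(2) that unfolding D_eq by blast
    obtain u where u: "u \<in> carrier_vec M" "G *\<^sub>v u = e"
      using surj car by blast
    define g where "g = f + (-1) \<cdot>\<^sub>v (A *\<^sub>v u)"
    have g: "g \<in> carrier_vec N" unfolding g_def using car A u by simp
    have "((-1) \<cdot>\<^sub>v (A *\<^sub>v u), (-1) \<cdot>\<^sub>v e) \<in> D'"
      using smult'[OF D'_mem[OF u(1)], of "-1"] u(2) by simp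
    then have "(g, e + (-1) \<cdot>\<^sub>v e) \<in> D'"
      using add'[OF fe] unfolding g_def by fastforce
    moreover have "e + (-1) \<cdot>\<^sub>v e = 0\<^sub>v N" using car by (intro eq_vecI) auto
    ultimately have g0: "(g, 0\<^sub>v N) \<in> D'" by simp
    \<comment> \<open>Since \<open>G\<close> is onto, every \<open>w\<close> is the effort of some element of \<open>?D\<close>; pair it with \<open>(g, 0)\<close>.\<close>
    have orth: "w \<bullet> g = 0" if w: "w \<in> carrier_vec N" for w
    proof -
      obtain v where v: "v \<in> carrier_vec M" "G *\<^sub>v v = w"
        using surj w by blast
      then have "bond_form (g, 0\<^sub>v N) (A *\<^sub>v v, w) = 0"
        using form'[OF g0 D'_mem] by blast
      then show ?thesis unfolding bond_form_def using A v by simp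
    qed
    have "f = A *\<^sub>v u"
    proof (intro eq_vecI)
      fix i assume "i < dim_vec (A *\<^sub>v u)"
      then have i: "i < N" using A by simp
      have "g $ i = 0" using orth[of "unit_vec N i"] scalar_prod_left_unit[OF g i] by simp
      then show "f $ i = (A *\<^sub>v u) $ i" unfolding g_def using car A u i by simp
    qed (use A car in simp)
    with u show "(f, e) \<in> ?D" unfolding D_eq by blast
  qed
  ultimately show ?thesis unfolding dirac_structure_def by blast
qed

lemma smult_mat_mult_vec:
  fixes A :: "'a :: comm_semiring_0 mat"
  assumes "A \<in> carrier_mat nr nc" "v \<in> carrier_vec nc"
  shows "(k \<cdot>\<^sub>m A) *\<^sub>v v = k \<cdot>\<^sub>v (A *\<^sub>v v)"
  using assms by (intro eq_vecI) auto

lemma flow_matrix_carrier: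
  assumes "Pfp \<in> carrier_mat Ntp Np" "Pfq \<in> carrier_mat Ntq Nq"
    "dp \<in> carrier_mat Np Mq" "dq \<in> carrier_mat Nq Mp"
    "Sp \<in> carrier_mat Mb Mp" "Shq \<in> carrier_mat Mhb Mq"
  shows "flow_matrix r Pfp Pfq dp dq Sp Shq \<in> carrier_mat ((Ntp + Ntq) + (Mhb + Mb)) (Mp + Mq)"
  unfolding flow_matrix_def using assms
  by (intro carrier_append_rows four_block_carrier_mat) auto

lemma effort_matrix_carrier:
  assumes "Pep \<in> carrier_mat Ntp Mp" "Peq \<in> carrier_mat Ntq Mq"
    "Tq \<in> carrier_mat Mb Mq" "Thp \<in> carrier_mat Mhb Mp"
  shows "effort_matrix Pep Peq Tq Thp \<in> carrier_mat ((Ntp + Ntq) + (Mhb + Mb)) (Mp + Mq)"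
  unfolding effort_matrix_def using assms
  by (intro carrier_append_rows four_block_carrier_mat) auto

lemma flow_matrix_mult_vec:
  assumes c: "Pfp \<in> carrier_mat Ntp Np" "Pfq \<in> carrier_mat Ntq Nq"
    "dp \<in> carrier_mat Np Mq" "dq \<in> carrier_mat Nq Mp"
    "Sp \<in> carrier_mat Mb Mp" "Shq \<in> carrier_mat Mhb Mq"
    and u: "a \<in> carrier_vec Mp" "b \<in> carrier_vec Mq"
  shows "flow_matrix r Pfp Pfq dp dq Sp Shq *\<^sub>v (a @\<^sub>v b) =
    (((-1) ^ r \<cdot>\<^sub>v (Pfp *\<^sub>v (dp *\<^sub>v b))) @\<^sub>v (Pfq *\<^sub>v (dq *\<^sub>v a))) @\<^sub>v ((Shq *\<^sub>v b) @\<^sub>v (Sp *\<^sub>v a))"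
proof -
  have top: "four_block_mat (0\<^sub>m Ntp Mp) ((-1) ^ r \<cdot>\<^sub>m (Pfp * dp)) (Pfq * dq) (0\<^sub>m Ntq Mq)
      *\<^sub>v (a @\<^sub>v b) = ((-1) ^ r \<cdot>\<^sub>v (Pfp *\<^sub>v (dp *\<^sub>v b))) @\<^sub>v (Pfq *\<^sub>v (dq *\<^sub>v a))"
    by (subst four_block_mat_mult_vec[of _ Ntp Mp _ Mq _ Ntq])
      (use c u in \<open>auto simp: smult_mat_mult_vec[of _ Ntp Mq]\<close>)
  have bottom: "four_block_mat (0\<^sub>m Mhb Mp) Shq Sp (0\<^sub>m Mb Mq) *\<^sub>v (a @\<^sub>v b)
      = (Shq *\<^sub>v b) @\<^sub>v (Sp *\<^sub>v a)"
    by (subst four_block_mat_mult_vec[of _ Mhb Mp _ Mq _ Mb]) (use c u in auto)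
  have dims: "dim_row Pfp = Ntp" "dim_col dq = Mp" "dim_row Pfq = Ntq" "dim_col dp = Mq"
    "dim_row Shq = Mhb" "dim_col Sp = Mp" "dim_row Sp = Mb" "dim_col Shq = Mq"
    using c by auto
  show ?thesis
    unfolding flow_matrix_def dims
    by (subst mat_mult_append[of _ "Ntp + Ntq" "Mp + Mq" _ "Mhb + Mb"])
      (use c u top bottom in auto)
qed

lemma effort_matrix_mult_vec:
  assumes c: "Pep \<in> carrier_mat Ntp Mp" "Peq \<in> carrier_mat Ntq Mq"
    "Tq \<in> carrier_mat Mb Mq" "Thp \<in> carrier_mat Mhb Mp"
    and u: "a \<in> carrier_vec Mp" "b \<in> carrier_vec Mq"
  shows "effort_matrix Pep Peq Tq Thp *\<^sub>v (a @\<^sub>v b) =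
    ((Pep *\<^sub>v a) @\<^sub>v (Peq *\<^sub>v b)) @\<^sub>v ((Thp *\<^sub>v a) @\<^sub>v (Tq *\<^sub>v b))"
proof -
  have top: "four_block_mat Pep (0\<^sub>m Ntp Mq) (0\<^sub>m Ntq Mp) Peq *\<^sub>v (a @\<^sub>v b)
      = (Pep *\<^sub>v a) @\<^sub>v (Peq *\<^sub>v b)"
    by (subst four_block_mat_mult_vec[of _ Ntp Mp _ Mq _ Ntq]) (use c u in auto)
  have bottom: "four_block_mat Thp (0\<^sub>m Mhb Mq) (0\<^sub>m Mb Mp) Tq *\<^sub>v (a @\<^sub>v b)
      = (Thp *\<^sub>v a) @\<^sub>v (Tq *\<^sub>v b)"
    by (subst four_block_mat_mult_vec[of _ Mhb Mp _ Mq _ Mb]) (use c u in auto)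
  have dims: "dim_row Pep = Ntp" "dim_col Peq = Mq" "dim_row Peq = Ntq" "dim_col Pep = Mp"
    "dim_row Thp = Mhb" "dim_col Tq = Mq" "dim_row Tq = Mb" "dim_col Thp = Mp"
    using c by auto
  show ?thesis
    unfolding effort_matrix_def dims
    by (subst mat_mult_append[of _ "Ntp + Ntq" "Mp + Mq" _ "Mhb + Mb"])
      (use c u top bottom in auto)
qed

lemma effort_matrix_kernel:
  fixes Pep Peq Tq Thp :: "real mat"
  assumes c: "Pep \<in> carrier_mat Ntp Mp" "Peq \<in> carrier_mat Ntq Mq"
    "Tq \<in> carrier_mat Mb Mq" "Thp \<in> carrier_mat Mhb Mp"
    and rank_p: "vec_space.rank (Ntp + Mhb) (Pep @\<^sub>r Thp) = Mp"
    and rank_q: "vec_space.rank (Ntq + Mb) (Peq @\<^sub>r Tq) = Mq"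
    and u: "u \<in> carrier_vec (Mp + Mq)"
    and ker: "effort_matrix Pep Peq Tq Thp *\<^sub>v u = 0\<^sub>v ((Ntp + Ntq) + (Mhb + Mb))"
  shows "u = 0\<^sub>v (Mp + Mq)"
proof -
  define a b where "a = vec_first u Mp" and "b = vec_last u Mq"
  have ab: "a \<in> carrier_vec Mp" "b \<in> carrier_vec Mq" "u = a @\<^sub>v b"
    using u unfolding a_def b_def by auto
  have split0: "0\<^sub>v (i + j) = 0\<^sub>v i @\<^sub>v (0\<^sub>v j :: real vec)" for i j
    by auto
  have "((Pep *\<^sub>v a) @\<^sub>v (Peq *\<^sub>v b)) @\<^sub>v ((Thp *\<^sub>v a) @\<^sub>v (Tq *\<^sub>v b))
      = (0\<^sub>v Ntp @\<^sub>v 0\<^sub>v Ntq) @\<^sub>v (0\<^sub>v Mhb @\<^sub>v 0\<^sub>v Mb)"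
    using ker effort_matrix_mult_vec[OF c ab(1,2)] unfolding ab(3) split0 by simp
  then have zeros: "Pep *\<^sub>v a = 0\<^sub>v Ntp" "Peq *\<^sub>v b = 0\<^sub>v Ntq"
      "Thp *\<^sub>v a = 0\<^sub>v Mhb" "Tq *\<^sub>v b = 0\<^sub>v Mb"
    using c ab
    by (simp_all add: append_vec_eq[of _ "Ntp + Ntq"] append_vec_eq[of _ Ntp]
        append_vec_eq[of _ Mhb])
  have "a = 0\<^sub>v Mp"
    by (rule vec_space.full_column_rank_kernel[OF _ rank_p ab(1)])
      (use c ab zeros in \<open>auto simp: mat_mult_append[of _ Ntp Mp _ Mhb]\<close>)
  moreover have "b = 0\<^sub>v Mq"
    by (rule vec_space.full_column_rank_kernel[OF _ rank_q ab(2)])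
      (use c ab zeros in \<open>auto simp: mat_mult_append[of _ Ntq Mq _ Mb]\<close>)
  ultimately show ?thesis using ab(3) by (simp add: split0)
qed

text \<open>
  The block matrix equation applied to \<open>a\<close> and paired with \<open>b\<close>. Here \<open>a\<close> and \<open>b\<close> need not come from
  the same effort vector; skew-symmetry uses this identity across two of them.
\<close>

lemma power_balance:
  fixes Pep Peq Pfp Pfq dp dq Tq Thp Sp Shq :: "real mat"
  assumes c: "Pep \<in> carrier_mat Ntp Mp" "Peq \<in> carrier_mat Ntq Mq"
    "Pfp \<in> carrier_mat Ntp Np" "Pfq \<in> carrier_mat Ntq Nq"
    "dp \<in> carrier_mat Np Mq" "dq \<in> carrier_mat Nq Mp"
    "Tq \<in> carrier_mat Mb Mq" "Thp \<in> carrier_mat Mhb Mp"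
    "Sp \<in> carrier_mat Mb Mp" "Shq \<in> carrier_mat Mhb Mq"
    and eq: "s \<cdot>\<^sub>m (dp\<^sup>T * Pfp\<^sup>T * Pep) + Peq\<^sup>T * Pfq * dq + Tq\<^sup>T * Sp + Shq\<^sup>T * Thp
         = 0\<^sub>m Mq Mp"
    and a: "a \<in> carrier_vec Mp" and b: "b \<in> carrier_vec Mq"
  shows "s * ((Pep *\<^sub>v a) \<bullet> (Pfp *\<^sub>v (dp *\<^sub>v b))) + (Peq *\<^sub>v b) \<bullet> (Pfq *\<^sub>v (dq *\<^sub>v a))
      + (Thp *\<^sub>v a) \<bullet> (Shq *\<^sub>v b) + (Tq *\<^sub>v b) \<bullet> (Sp *\<^sub>v a) = 0"
proof -
  define X1 where "X1 = dp\<^sup>T *\<^sub>v (Pfp\<^sup>T *\<^sub>v (Pep *\<^sub>v a))"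
  define X2 where "X2 = Peq\<^sup>T *\<^sub>v (Pfq *\<^sub>v (dq *\<^sub>v a))"
  define X3 where "X3 = Tq\<^sup>T *\<^sub>v (Sp *\<^sub>v a)"
  define X4 where "X4 = Shq\<^sup>T *\<^sub>v (Thp *\<^sub>v a)"
  note X = X1_def X2_def X3_def X4_def
  have Xc: "X1 \<in> carrier_vec Mq" "X2 \<in> carrier_vec Mq" "X3 \<in> carrier_vec Mq" "X4 \<in> carrier_vec Mq"
    using c a unfolding X by auto
  have "s \<cdot>\<^sub>v X1 + X2 + X3 + X4 = 0\<^sub>m Mq Mp *\<^sub>v a"
    unfolding eq[symmetric] X using c a
    by (simp add: add_mult_distrib_mat_vec[of _ Mq Mp] smult_mat_mult_vec[of _ Mq Mp]
        assoc_mult_mat_vec[of _ Mq Np _ Mp] assoc_mult_mat_vec[of _ Mq Ntp _ Mp]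
        assoc_mult_mat_vec[of _ Mq Ntq _ Mp] mult_carrier_mat[of Pfq Ntq Nq])
  also have "0\<^sub>m Mq Mp *\<^sub>v a = 0\<^sub>v Mq"
    using a by (intro eq_vecI) auto
  finally have "(s \<cdot>\<^sub>v X1 + X2 + X3 + X4) \<bullet> b = 0"
    using b by simp
  then have "s * (X1 \<bullet> b) + X2 \<bullet> b + X3 \<bullet> b + X4 \<bullet> b = 0"
    using Xc b by (simp add: add_scalar_prod_distrib[of _ Mq])
  moreover have "X1 \<bullet> b = (Pep *\<^sub>v a) \<bullet> (Pfp *\<^sub>v (dp *\<^sub>v b))"
    unfolding X using c a b
    by (simp add: transpose_vec_mult_scalar[of dp Np Mq] transpose_vec_mult_scalar[of Pfp Ntp Np])
  moreover have "X2 \<bullet> b = (Peq *\<^sub>v b) \<bullet> (Pfq *\<^sub>v (dq *\<^sub>v a))"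
    unfolding X using c a b
    by (simp add: transpose_vec_mult_scalar[of Peq Ntq Mq] comm_scalar_prod[of _ Ntq])
  moreover have "X3 \<bullet> b = (Tq *\<^sub>v b) \<bullet> (Sp *\<^sub>v a)"
    unfolding X using c a b
    by (simp add: transpose_vec_mult_scalar[of Tq Mb Mq] comm_scalar_prod[of _ Mb])
  moreover have "X4 \<bullet> b = (Thp *\<^sub>v a) \<bullet> (Shq *\<^sub>v b)"
    unfolding X using c a b
    by (simp add: transpose_vec_mult_scalar[of Shq Mhb Mq])
  ultimately show ?thesis by simp
qed

theorem proposition5:
  fixes n p q r Np Nq Mp Mq Mb Mhb Ntp Ntq N :: nat
    and Pep Peq Pfp Pfq dp dq Tq Thp Sp Shq :: "real mat"
  assumes "p + q = n + 1" and "r = p * q + 1"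
    and "Pep \<in> carrier_mat Ntp Mp" and "Peq \<in> carrier_mat Ntq Mq"
    and "Pfp \<in> carrier_mat Ntp Np" and "Pfq \<in> carrier_mat Ntq Nq"
    and "dp \<in> carrier_mat Np Mq" and "dq \<in> carrier_mat Nq Mp"
    and "Tq \<in> carrier_mat Mb Mq" and "Thp \<in> carrier_mat Mhb Mp"
    and "Sp \<in> carrier_mat Mb Mp" and "Shq \<in> carrier_mat Mhb Mq"
    and "N = Ntp + Ntq + Mhb + Mb"
    and "Ntp + Ntq + Mhb + Mb = Mp + Mq"
    and "(-1) ^ r \<cdot>\<^sub>m (dp\<^sup>T * Pfp\<^sup>T * Pep) + Peq\<^sup>T * Pfq * dq + Tq\<^sup>T * Sp + Shq\<^sup>T * Thp
         = 0\<^sub>m Mq Mp"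
    and "vec_space.rank (Ntp + Mhb) (Pep @\<^sub>r Thp) = Mp"
    and "vec_space.rank (Ntq + Mb) (Peq @\<^sub>r Tq) = Mq"
  shows "dirac_structure N
           {(f, e). f \<in> carrier_vec N \<and> e \<in> carrier_vec N \<and>
              (\<exists>u \<in> carrier_vec (Mp + Mq).
                 f = flow_matrix r Pfp Pfq dp dq Sp Shq *\<^sub>v u \<and>
                 e = effort_matrix Pep Peq Tq Thp *\<^sub>v u)}"
proof -
  define A where "A = flow_matrix r Pfp Pfq dp dq Sp Shq"
  define G where "G = effort_matrix Pep Peq Tq Thp"
  note carriers = assms(3-12)
  have N: "N = (Ntp + Ntq) + (Mhb + Mb)" and M: "Mp + Mq = N"
    using assms(13,14) by auto
  have A: "A \<in> carrier_mat N (Mp + Mq)" and G: "G \<in> carrier_mat N (Mp + Mq)"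
    unfolding A_def G_def N using carriers
    by (auto intro!: flow_matrix_carrier effort_matrix_carrier)
  have kernel: "u = 0\<^sub>v (Mp + Mq)" if "u \<in> carrier_vec (Mp + Mq)" "G *\<^sub>v u = 0\<^sub>v N" for u
    using effort_matrix_kernel[OF carriers(1,2,7,8) assms(16,17) that(1)] that(2)
    unfolding G_def N by blast
  have surj: "\<exists>u\<in>carrier_vec (Mp + Mq). G *\<^sub>v u = e" if "e \<in> carrier_vec N" for e
    using injective_square_mat_surj[of G N e] kernel that G unfolding M by blast
  have skew: "(G *\<^sub>v u) \<bullet> (A *\<^sub>v v) + (G *\<^sub>v v) \<bullet> (A *\<^sub>v u) = 0"
    if u: "u \<in> carrier_vec (Mp + Mq)" and v: "v \<in> carrier_vec (Mp + Mq)" for u v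
  proof -
    have pairing: "(G *\<^sub>v (a @\<^sub>v b)) \<bullet> (A *\<^sub>v (a' @\<^sub>v b')) =
        (-1) ^ r * ((Pep *\<^sub>v a) \<bullet> (Pfp *\<^sub>v (dp *\<^sub>v b'))) + (Peq *\<^sub>v b) \<bullet> (Pfq *\<^sub>v (dq *\<^sub>v a'))
        + (Thp *\<^sub>v a) \<bullet> (Shq *\<^sub>v b') + (Tq *\<^sub>v b) \<bullet> (Sp *\<^sub>v a')"
      if "a \<in> carrier_vec Mp" "b \<in> carrier_vec Mq" "a' \<in> carrier_vec Mp" "b' \<in> carrier_vec Mq"
      for a b a' b'
      unfolding A_def G_def effort_matrix_mult_vec[OF carriers(1,2,7,8) that(1,2)]
        flow_matrix_mult_vec[OF carriers(3-6,9,10) that(3,4)]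
      using carriers that
      by (simp add: scalar_prod_append[of _ "Ntp + Ntq" _ "Mhb + Mb"]
          scalar_prod_append[of _ Ntp _ Ntq] scalar_prod_append[of _ Mhb _ Mb])
    define a b a' b' where "a = vec_first u Mp" and "b = vec_last u Mq"
      and "a' = vec_first v Mp" and "b' = vec_last v Mq"
    have ab: "a \<in> carrier_vec Mp" "b \<in> carrier_vec Mq" "u = a @\<^sub>v b"
      and ab': "a' \<in> carrier_vec Mp" "b' \<in> carrier_vec Mq" "v = a' @\<^sub>v b'"
      using u v unfolding a_def b_def a'_def b'_def by auto
    \<comment> \<open>The sum of the two pairings regroups into one balance for \<open>(a, b')\<close> and one for \<open>(a', b)\<close>.\<close>
    show ?thesis
      using power_balance[OF carriers assms(15) ab(1) ab'(2)]
        power_balance[OF carriers assms(15) ab'(1) ab(2)]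
      unfolding ab(3) ab'(3) pairing[OF ab(1,2) ab'(1,2)] pairing[OF ab'(1,2) ab(1,2)]
      by simp
  qed
  show ?thesis
    using dirac_structure_image_rep[OF A G surj skew] unfolding A_def G_def .
qed

end
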